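(* Every equivalence structure $\mathcal{E}=(\omega,E)$ has a strongly generically computable copy.
   Context: An equivalence structure $(\omega,E)$ is the set $\omega$ with an equivalence relation $E$ on it; a copy is an isomorphic structure $(\omega,E^* )$. A set $S\subseteq\omega$ has asymptotic density $\delta$ if $\lim_{n\to\infty} |S\cap\{0,\dots,n\}|/(n+1)=\delta$. An equivalence structure $(\omega,R)$ is strongly generically computable if there are a computable equivalence relation $S$ on $\omega$ and a computably enumerable set $A$ of asymptotic density 1 such that $R$ agrees with $S$ on $A\times A$. *)

theory Defs
  imports Complex_Main
begin

text \<open>
  The libraries contain no notion of computable function, so the partial recursive functions are
  defined here in the standard way (Kleene's schemes). Arities are not tracked: an expression
  denotes a partial function on argument lists, \<open>None\<close> meaning divergence, and on lists of a fixed
  length \<open>k\<close> these are exactly the \<open>k\<close>-ary partial recursive functions.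
\<close>

datatype recfn =
    Zero
  | Successor
  | Proj nat
  | Compose recfn "recfn list"
  | PrimRec recfn recfn
  | Minimize recfn

text \<open>
  Composition is strict in all its arguments, and \<open>PrimRec f g\<close> recurses on the first argument.
  \<open>Minimize f\<close> is the \<open>\<mu>\<close>-operator: it converges to \<open>n\<close> only if \<open>f\<close> converges to a nonzero value at
  every \<open>m < n\<close> and to zero at \<open>n\<close>.
\<close>

fun apply_rec :: "recfn \<Rightarrow> nat list \<Rightarrow> nat option" where
  "apply_rec Zero xs = Some 0"
| "apply_rec Successor xs = (case xs of [] \<Rightarrow> None | x # _ \<Rightarrow> Some (Suc x))"
| "apply_rec (Proj i) xs = (if i < length xs then Some (xs ! i) else None)"
| "apply_rec (Compose f gs) xs =
     (if \<forall>g\<in>set gs. apply_rec g xs \<noteq> None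
      then apply_rec f (map (\<lambda>g. the (apply_rec g xs)) gs)
      else None)"
| "apply_rec (PrimRec f g) xs =
     (case xs of
        [] \<Rightarrow> None
      | n # ys \<Rightarrow>
          rec_nat (apply_rec f ys)
            (\<lambda>k r. case r of None \<Rightarrow> None | Some v \<Rightarrow> apply_rec g (k # v # ys)) n)"
| "apply_rec (Minimize f) xs =
     (if \<exists>n. apply_rec f (n # xs) = Some 0 \<and> (\<forall>m<n. \<exists>v. apply_rec f (m # xs) = Some (Suc v))
      then Some (LEAST n. apply_rec f (n # xs) = Some 0)
      else None)"

definition computable_relation :: "(nat \<times> nat) set \<Rightarrow> bool" where
  "computable_relation R \<longleftrightarrow>
     (\<exists>f. \<forall>x y. apply_rec f [x, y] = Some (if (x, y) \<in> R then 1 else 0))"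

definition computably_enumerable :: "nat set \<Rightarrow> bool" where
  "computably_enumerable A \<longleftrightarrow> (\<exists>f. A = {x. apply_rec f [x] \<noteq> None})"

definition has_asymptotic_density :: "nat set \<Rightarrow> real \<Rightarrow> bool" where
  "has_asymptotic_density S \<delta> \<longleftrightarrow>
     (\<lambda>n. real (card (S \<inter> {0..n})) / real (n + 1)) \<longlonglongrightarrow> \<delta>"

abbreviation equivalence_structure :: "(nat \<times> nat) set \<Rightarrow> bool" where
  "equivalence_structure E \<equiv> equiv UNIV E"

definition is_copy :: "(nat \<times> nat) set \<Rightarrow> (nat \<times> nat) set \<Rightarrow> bool" where
  "is_copy E R \<longleftrightarrow>
     equivalence_structure R \<and> (\<exists>h. bij h \<and> (\<forall>x y. (x, y) \<in> E \<longleftrightarrow> (h x, h y) \<in> R))"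

definition strongly_generically_computable :: "(nat \<times> nat) set \<Rightarrow> bool" where
  "strongly_generically_computable R \<longleftrightarrow>
     (\<exists>S A. equiv UNIV S \<and> computable_relation S \<and>
            computably_enumerable A \<and> has_asymptotic_density A 1 \<and>
            (\<forall>x\<in>A. \<forall>y\<in>A. (x, y) \<in> R \<longleftrightarrow> (x, y) \<in> S))"

end

theory Submission
  imports Defs "HOL-Library.Ramsey" "HOL-Real_Asymp.Real_Asymp"
begin

text \<open>
  By Ramsey's theorem an equivalence relation \<open>E\<close> on \<open>\<omega>\<close> has an infinite homogeneous set \<open>H\<close>: its
  elements are either pairwise equivalent or pairwise inequivalent.  So on \<open>H\<close> the relation \<open>E\<close>
  coincides with one of the two trivial equivalence relations, \<open>UNIV\<close> and \<open>Id\<close>, both of which are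
  computable.  Thinning \<open>H\<close> out makes its complement infinite too, and then some permutation of
  \<open>\<omega>\<close> carries \<open>H\<close> onto any prescribed infinite, coinfinite set.  Carrying \<open>H\<close> onto the nonsquares,
  which are computably enumerable and have density 1, and transporting \<open>E\<close> along the permutation
  gives the copy: however complicated \<open>E\<close> is, a pair of numbers on which the copy departs from
  the trivial relation has to contain a square.
\<close>

section \<open>Some recursive functions\<close>

definition rec_pred :: recfn where
  "rec_pred = PrimRec Zero (Proj 0)"

text \<open>The subtrahend comes first, because primitive recursion runs on the first argument.\<close>

definition rec_subtract_from :: recfn where
  "rec_subtract_from = PrimRec (Proj 0) (Compose rec_pred [Proj 1])"

definition rec_add :: recfn where
  "rec_add = PrimRec (Proj 0) (Compose Successor [Proj 1])"

definition rec_mult :: recfn where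
  "rec_mult = PrimRec Zero (Compose rec_add [Proj 1, Proj 2])"

lemma apply_rec_pred [simp]: "apply_rec rec_pred [n] = Some (n - 1)"
  unfolding rec_pred_def by (induction n) auto

lemma apply_rec_subtract_from [simp]: "apply_rec rec_subtract_from [n, x] = Some (x - n)"
  unfolding rec_subtract_from_def by (induction n) auto

lemma apply_rec_add [simp]: "apply_rec rec_add [n, x] = Some (n + x)"
  unfolding rec_add_def by (induction n) auto

lemma apply_rec_mult [simp]: "apply_rec rec_mult [n, x] = Some (n * x)"
  unfolding rec_mult_def by (induction n) auto

text \<open>
  On a total function the side condition of the \<open>\<mu>\<close>-operator, convergence to nonzero values
  before the first zero, is automatic.
\<close>

lemma Minimize_converges_iff:
  assumes "\<And>n. apply_rec f (n # xs) = Some (v n)"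
  shows "apply_rec (Minimize f) xs \<noteq> None \<longleftrightarrow> (\<exists>n. v n = 0)"
proof -
  have "(\<exists>n. v n = 0) \<longleftrightarrow> (\<exists>n. v n = 0 \<and> (\<forall>m<n. \<exists>w. v m = Suc w))"
    using exists_least_iff[of "\<lambda>n. v n = 0"] by (metis not0_implies_Suc)
  then show ?thesis
    by (simp add: assms)
qed

lemma computable_relation_UNIV: "computable_relation UNIV"
proof -
  have "apply_rec (Compose Successor [Zero]) [x, y] = Some 1" for x y
    by simp
  then show ?thesis
    unfolding computable_relation_def by (metis UNIV_I)
qed

text \<open>The characteristic function of equality is \<open>1 - ((y - x) + (x - y))\<close> in truncated arithmetic.\<close>

lemma computable_relation_Id: "computable_relation Id"
proof -
  let ?f = "Compose rec_subtract_from
    [Compose rec_add [rec_subtract_from, Compose rec_subtract_from [Proj 1, Proj 0]],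
     Compose Successor [Zero]]"
  have "apply_rec ?f [x, y] = Some (if (x, y) \<in> Id then 1 else 0)" for x y
    by auto
  then show ?thesis
    unfolding computable_relation_def by blast
qed

section \<open>The nonsquares\<close>

definition nonsquares :: "nat set" where
  "nonsquares = - range (\<lambda>k. k * k)"

text \<open>
  Being strictly between two consecutive squares is an existential condition, so an unbounded
  search semidecides it.
\<close>

lemma nonsquare_iff: "x \<in> nonsquares \<longleftrightarrow> (\<exists>n. n * n < x \<and> x < Suc n * Suc n)"
proof
  assume x: "x \<in> nonsquares"
  define m where "m = (LEAST m. x < m * m)"
  have "x < Suc x * Suc x"
    by simp
  then have m: "x < m * m" and least: "\<And>k. k < m \<Longrightarrow> \<not> x < k * k"
    unfolding m_def by (rule LeastI, use not_less_Least in blast)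
  from m obtain n where n: "m = Suc n"
    by (cases m) auto
  have "x \<noteq> n * n"
    using x unfolding nonsquares_def by blast
  then have "n * n < x"
    using least[of n] n by simp
  then show "\<exists>n. n * n < x \<and> x < Suc n * Suc n"
    using m n by blast
next
  assume "\<exists>n. n * n < x \<and> x < Suc n * Suc n"
  then obtain n where n: "n * n < x" "x < Suc n * Suc n"
    by blast
  have "x \<noteq> k * k" for k
  proof (cases "k \<le> n")
    case True
    then have "k * k \<le> n * n"
      by (intro mult_le_mono)
    then show ?thesis
      using n by simp
  next
    case False
    then have "Suc n * Suc n \<le> k * k"
      by (intro mult_le_mono) auto
    then show ?thesis
      using n by linarith
  qed
  then show "x \<in> nonsquares"
    unfolding nonsquares_def by blast
qed

lemma computably_enumerable_nonsquares: "computably_enumerable nonsquares"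
proof -
  \<comment> \<open>The two truncated differences vanish together exactly if \<open>n * n < x < (n + 1) * (n + 1)\<close>.\<close>
  define v where "v x n = (Suc (n * n) - x) + (Suc x - Suc n * Suc n)" for x n :: nat
  let ?f = "Compose rec_add
    [Compose rec_subtract_from [Proj 1, Compose Successor [Compose rec_mult [Proj 0, Proj 0]]],
     Compose rec_subtract_from
       [Compose rec_mult [Compose Successor [Proj 0], Compose Successor [Proj 0]],
        Compose Successor [Proj 1]]]"
  have "apply_rec ?f (n # [x]) = Some (v x n)" for n x
    unfolding v_def by simp
  then have "apply_rec (Minimize ?f) [x] \<noteq> None \<longleftrightarrow> (\<exists>n. v x n = 0)" for x
    by (rule Minimize_converges_iff)
  moreover have "v x n = 0 \<longleftrightarrow> n * n < x \<and> x < Suc n * Suc n" for x n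
    unfolding v_def by (simp only: add_is_0 diff_is_0_eq Suc_le_eq less_Suc_eq_le Suc_le_mono)
  ultimately have "nonsquares = {x. apply_rec (Minimize ?f) [x] \<noteq> None}"
    by (intro set_eqI) (simp only: mem_Collect_eq nonsquare_iff)
  then show ?thesis
    unfolding computably_enumerable_def by blast
qed

text \<open>At most \<open>sqrt n + 1\<close> of the numbers up to \<open>n\<close> are squares.\<close>

lemma has_asymptotic_density_nonsquares: "has_asymptotic_density nonsquares 1"
proof -
  have count: "real n - sqrt n \<le> card (nonsquares \<inter> {0..n})" for n
  proof -
    let ?Q = "(\<lambda>k. k * k) ` {0..nat \<lfloor>sqrt n\<rfloor>}"
    have "k \<le> nat \<lfloor>sqrt n\<rfloor>" if "k * k \<le> n" for k
    proof -
      have "real k * real k \<le> real n"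
        using that by (metis of_nat_le_iff of_nat_mult)
      then have "real k \<le> sqrt n"
        by (simp add: real_le_rsqrt power2_eq_square)
      then show ?thesis
        by (simp add: le_nat_floor)
    qed
    then have "{0..n} \<subseteq> (nonsquares \<inter> {0..n}) \<union> ?Q"
      unfolding nonsquares_def by auto
    then have "card {0..n} \<le> card ((nonsquares \<inter> {0..n}) \<union> ?Q)"
      by (intro card_mono) auto
    also have "\<dots> \<le> card (nonsquares \<inter> {0..n}) + card ?Q"
      by (rule card_Un_le)
    also have "card ?Q \<le> Suc (nat \<lfloor>sqrt n\<rfloor>)"
      using card_image_le[of "{0..nat \<lfloor>sqrt n\<rfloor>}" "\<lambda>k. k * k"] by simp
    finally have "n \<le> card (nonsquares \<inter> {0..n}) + nat \<lfloor>sqrt n\<rfloor>"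
      by simp
    moreover have "real (nat \<lfloor>sqrt n\<rfloor>) \<le> sqrt n"
      by simp
    ultimately show ?thesis
      by linarith
  qed
  let ?ratio = "\<lambda>n. real (card (nonsquares \<inter> {0..n})) / real (n + 1)"
  have lower: "\<forall>\<^sub>F n in sequentially. (real n - sqrt n) / real (n + 1) \<le> ?ratio n"
    using count by (intro always_eventually allI divide_right_mono) auto
  have "card (nonsquares \<inter> {0..n}) \<le> n + 1" for n
    using card_mono[of "{0..n}" "nonsquares \<inter> {0..n}"] by simp
  then have upper: "\<forall>\<^sub>F n in sequentially. ?ratio n \<le> 1"
    by (intro always_eventually allI) (simp add: divide_le_eq_1 flip: of_nat_Suc)
  have "(\<lambda>n. (real n - sqrt n) / real (n + 1)) \<longlonglongrightarrow> 1"
    by real_asymp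
  then show ?thesis
    unfolding has_asymptotic_density_def
    by (rule tendsto_sandwich[OF lower upper _ tendsto_const])
qed

lemma infinite_nonsquares: "infinite nonsquares"
proof (rule infinite_super)
  show "range (\<lambda>n. Suc (Suc n * Suc n)) \<subseteq> nonsquares"
  proof clarify
    fix n
    have "Suc n * Suc n < Suc (Suc n * Suc n)" "Suc (Suc n * Suc n) < Suc (Suc n) * Suc (Suc n)"
      by simp_all
    then show "Suc (Suc n * Suc n) \<in> nonsquares"
      unfolding nonsquare_iff by blast
  qed
  have "inj (\<lambda>n. Suc (Suc n * Suc n))"
    by (simp add: strict_mono_imp_inj_on strict_mono_Suc_iff)
  then show "infinite (range (\<lambda>n. Suc (Suc n * Suc n)))"
    by (rule range_inj_infinite)
qed

lemma infinite_squares: "infinite (- nonsquares)"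
proof -
  have "inj (\<lambda>k :: nat. k * k)"
    by (simp add: strict_mono_imp_inj_on strict_mono_Suc_iff)
  then show ?thesis
    unfolding nonsquares_def by (simp add: range_inj_infinite)
qed

section \<open>Moving a homogeneous set\<close>

text \<open>Every second element of an infinite set is left out.\<close>

lemma infinite_coinfinite_subset:
  fixes H :: "nat set"
  assumes "infinite H"
  obtains K where "K \<subseteq> H" "infinite K" "infinite (- K)"
proof
  have inj: "inj (enumerate H)"
    using assms strict_mono_enumerate strict_mono_imp_inj_on by blast
  let ?K = "range (\<lambda>n. enumerate H (2 * n))"
  show "?K \<subseteq> H"
    using assms enumerate_in_set by blast
  show "infinite ?K"
    by (intro range_inj_infinite injI) (auto dest: injD[OF inj])
  have "infinite (range (\<lambda>n. enumerate H (2 * n + 1)))"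
    by (intro range_inj_infinite injI) (auto dest: injD[OF inj])
  moreover have "enumerate H (2 * n + 1) \<noteq> enumerate H (2 * m)" for n m
    by (simp only: inj_eq[OF inj]) presburger
  then have "range (\<lambda>n. enumerate H (2 * n + 1)) \<subseteq> - ?K"
    by auto
  ultimately show "infinite (- ?K)"
    by (rule infinite_super[rotated])
qed

lemma bij_mapping_infinite_coinfinite:
  fixes A B :: "nat set"
  assumes "infinite A" "infinite (- A)" "infinite B" "infinite (- B)"
  obtains h where "bij h" "h ` A = B"
proof -
  have bij: "\<exists>f. bij_betw f X Y" if "infinite X" "infinite Y" for X Y :: "nat set"
    using that bij_enumerate bij_betw_inv_into bij_betw_trans by metis
  obtain f g where f: "bij_betw f A B" and g: "bij_betw g (- A) (- B)"
    using bij assms by metis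
  let ?h = "\<lambda>x. if x \<in> A then f x else g x"
  have "bij_betw ?h (A \<union> - A) (B \<union> - B)"
    using f g by (intro bij_betw_disjoint_Un) auto
  moreover have "?h ` A = B"
    using f by (auto simp: bij_betw_def)
  ultimately show thesis
    using that by simp
qed

text \<open>
  This is Ramsey's theorem for the colouring of pairs by whether they are equivalent.  Reflexivity
  of \<open>E\<close> takes care of the diagonal, which the colouring does not see.
\<close>

lemma infinite_homogeneous_subset:
  fixes E :: "(nat \<times> nat) set"
  assumes "equiv UNIV E"
  obtains H S where "infinite H" "S = UNIV \<or> S = Id"
    "\<And>x y. x \<in> H \<Longrightarrow> y \<in> H \<Longrightarrow> (x, y) \<in> E \<longleftrightarrow> (x, y) \<in> S"
proof -
  have E: "(x, x) \<in> E" "(x, y) \<in> E \<Longrightarrow> (y, x) \<in> E" for x y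
    using assms by (auto simp: equiv_def refl_on_def sym_def)
  define colour :: "nat set \<Rightarrow> nat" where
    "colour X = (if X \<times> X \<subseteq> E then 1 else 0)" for X
  have pair: "colour {x, y} = (if (x, y) \<in> E then 1 else 0)" for x y
    unfolding colour_def using E by auto
  have "\<forall>x\<in>UNIV. \<forall>y\<in>UNIV. x \<noteq> y \<longrightarrow> colour {x, y} < 2"
    by (simp add: pair)
  from Ramsey2[OF infinite_UNIV_nat this] obtain H t where "infinite H"
    and t: "\<forall>x\<in>H. \<forall>y\<in>H. x \<noteq> y \<longrightarrow> colour {x, y} = t"
    by blast
  moreover have "(x, y) \<in> E \<longleftrightarrow> (x, y) \<in> (if t = 1 then UNIV else Id)"
    if "x \<in> H" "y \<in> H" for x y
    using t that E pair by (cases "x = y") (auto split: if_splits)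
  ultimately show thesis
    using that[of H "if t = 1 then UNIV else Id"] by auto
qed

theorem proposition2p5:
  fixes E :: "(nat \<times> nat) set"
  assumes "equivalence_structure E"
  shows "\<exists>R. is_copy E R \<and> strongly_generically_computable R"
proof -
  obtain H S where H: "infinite H" and S: "S = UNIV \<or> S = Id"
    and agree: "\<And>x y. x \<in> H \<Longrightarrow> y \<in> H \<Longrightarrow> (x, y) \<in> E \<longleftrightarrow> (x, y) \<in> S"
    using infinite_homogeneous_subset[OF assms] by metis
  obtain K where K: "K \<subseteq> H" "infinite K" "infinite (- K)"
    using infinite_coinfinite_subset[OF H] by metis
  obtain h where h: "bij h" "h ` K = nonsquares"
    using bij_mapping_infinite_coinfinite[OF K(2,3) infinite_nonsquares infinite_squares] by metis
  define R where "R = {(h x, h y) | x y. (x, y) \<in> E}"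
  have R_iff: "(h x, h y) \<in> R \<longleftrightarrow> (x, y) \<in> E" for x y
    unfolding R_def using h(1) by (auto dest: bij_is_inj injD)
  have surj: "\<exists>x. u = h x" for u
    using h(1) by (metis bij_pointE)
  have "equiv UNIV R"
  proof (rule equivI)
    show "refl R"
      by (rule refl_onI) (metis R_iff surj assms equiv_def UNIV_I refl_onD)
    show "sym R"
      by (rule symI) (metis R_iff surj assms equiv_def symD)
    show "trans R"
      by (rule transI) (metis R_iff surj assms equiv_def transD)
  qed simp
  then have "is_copy E R"
    unfolding is_copy_def using h(1) R_iff by blast
  moreover have "\<forall>u\<in>nonsquares. \<forall>v\<in>nonsquares. (u, v) \<in> R \<longleftrightarrow> (u, v) \<in> S"
  proof -
    \<comment> \<open>Both candidates for \<open>S\<close> are invariant under every permutation.\<close>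
    have "(h x, h y) \<in> S \<longleftrightarrow> (x, y) \<in> S" for x y
      using S h(1) by (auto dest: bij_is_inj injD)
    then show ?thesis
      unfolding h(2)[symmetric] using R_iff agree K(1) by blast
  qed
  moreover have "equiv UNIV S"
    using S by (auto simp: equiv_def refl_on_def sym_def trans_def)
  moreover have "computable_relation S"
    using S computable_relation_UNIV computable_relation_Id by blast
  ultimately show ?thesis
    unfolding strongly_generically_computable_def
    using computably_enumerable_nonsquares has_asymptotic_density_nonsquares by blast
qed

end
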